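(* Let $\mu,\mu'$ be probability measures on $\mathbb Z$ whose supports satisfy $S_\mu\subset\mathbb Z^+$ and $S_{\mu'}\subset\mathbb Z^-$, and let $\mathcal X^{(0)}=\mathcal X^{(0)}(\mu,\mu')$ be the associated oscillating random walk. Let $\delta=d\wedge d'$ be the greatest common divisor of $d$ and $d'$. (1) Assume $D$ and $D'$ are finite. Then: (i) there exist $\delta$ irreducible essential classes, namely $\{D',\ldots,D-1\}\cap(r+\delta\mathbb Z)$ with $0\le r<\delta$ (in particular, the irreducible class of $0$ is $\mathcal I(0)=\{D',\ldots,D-1\}\cap\delta\mathbb Z$); (ii) if $x\ge D$ or $x<D'$, then $x$ is transient and the chain started at $x$ reaches, $\mathbb P$-a.s. after finitely many steps, the essential class $\{D',\ldots,D-1\}\cap(r_x+\delta\mathbb Z)$. (2) Assume $D'=-\infty$ and $D$ is finite. Then: (i) there exist $\delta$ irreducible essential classes, namely $\,]-\infty,D-1]\cap(r+\delta\mathbb Z)$ with $0\le r<\delta$; (ii) every $x\ge D$ is transient and the chain started at $x$ reaches, $\mathbb P$-a.s. after finitely many steps, the essential class $\,]-\infty,D-1]\cap(r_x+\delta\mathbb Z)$. (2') Assume $D'$ is finite and $D=+\infty$. Then: (i) there exist $\delta$ irreducible essential classes, namely $[D',+\infty[\,\cap(r+\delta\mathbb Z)$ with $0\le r<\delta$; (ii) every $x<D'$ is transient and the chain started at $x$ reaches, $\mathbb P$-a.s. after finitely many steps, the essential class $[D',+\infty[\,\cap(r_x+\delta\mathbb Z)$. (3) Assume $D=+\infty$ and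 $D'=-\infty$. Then there exist $\delta$ irreducible classes, which are all essential: $r+\delta\mathbb Z$ with $0\le r<\delta$.
   Context: $\mathbb Z^+$ (resp. $\mathbb Z^-$) is the set of positive (resp. negative) integers. $S_\mu,S_{\mu'}$ are the supports of $\mu,\mu'$. $D=\max S_\mu$ (with $D=+\infty$ if $S_\mu$ is unbounded above), $D'=\min S_{\mu'}$ (with $D'=-\infty$ if $S_{\mu'}$ is unbounded below), $d=\gcd(S_\mu)$, $d'=\gcd(S_{\mu'})$. For $x\in\mathbb Z$, $r_x$ is the remainder of $x$ in the Euclidean division by $\delta$, $0\le r_x<\delta$. The chain $\mathcal X^{(0)}(\mu,\mu')=(X_n^{(0)})_{n\ge0}$ is the Markov chain on $\mathbb Z$ with $X_{n+1}^{(0)}=X_n^{(0)}+\xi_{n+1}$ if $X_n^{(0)}\le-1$ and $X_{n+1}^{(0)}=X_n^{(0)}+\xi'_{n+1}$ if $X_n^{(0)}\ge0$, where $(\xi_n,\xi_n')_{n\ge1}$ is i.i.d., $\xi_n$ has law $\mu$ and $\xi'_n$ has law $\mu'$. Write $x\to y$ if $\mathbb P_x[X_n^{(0)}=y]>0$ for some $n\ge0$. The irreducible class $\mathcal I(x)$ of $x$ is the set of $y$ with $x\to y$ and $y\to x$. The relation $\to$ induces a partial order on irreducible classes; the maximal (i.e. closed) classes are called essential, and the non-essential classes, and their points, are called transient. *)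

theory Defs
  imports "HOL-Probability.Probability"
begin

text \<open>The pairs \<open>(\<xi> n, \<xi>' n)\<close>, \<open>n \<ge> 1\<close>, are i.i.d. with marginal laws \<open>\<mu>\<close> and \<open>\<mu>'\<close>.
  Nothing is assumed on the dependence between \<open>\<xi> n\<close> and \<open>\<xi>' n\<close> at the same time \<open>n\<close>,
  and the variables with index \<open>0\<close> play no role.\<close>

definition iid_steps ::
  "'w measure \<Rightarrow> int pmf \<Rightarrow> int pmf \<Rightarrow> (nat \<Rightarrow> 'w \<Rightarrow> int) \<Rightarrow> (nat \<Rightarrow> 'w \<Rightarrow> int) \<Rightarrow> bool" where
  "iid_steps M \<mu> \<mu>' \<xi> \<xi>' \<longleftrightarrow>
     prob_space M \<and>
     prob_space.indep_vars M (\<lambda>_. count_space UNIV) (\<lambda>n \<omega>. (\<xi> n \<omega>, \<xi>' n \<omega>)) {1..} \<and>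
     (\<forall>n\<ge>1. distr M (count_space UNIV) (\<lambda>\<omega>. (\<xi> n \<omega>, \<xi>' n \<omega>)) =
            distr M (count_space UNIV) (\<lambda>\<omega>. (\<xi> 1 \<omega>, \<xi>' 1 \<omega>))) \<and>
     (\<forall>n\<ge>1. distr M (count_space UNIV) (\<xi> n) = measure_pmf \<mu>) \<and>
     (\<forall>n\<ge>1. distr M (count_space UNIV) (\<xi>' n) = measure_pmf \<mu>')"

text \<open>\<open>osc_walk \<xi> \<xi>' x n\<close> is the position at time \<open>n\<close> of the walk started at \<open>x\<close>, so that
  probabilities under \<open>P\<^sub>x\<close> are probabilities under \<open>M\<close> of events about
  \<open>osc_walk \<xi> \<xi>' x\<close>.\<close>

primrec osc_walk ::
  "(nat \<Rightarrow> 'w \<Rightarrow> int) \<Rightarrow> (nat \<Rightarrow> 'w \<Rightarrow> int) \<Rightarrow> int \<Rightarrow> nat \<Rightarrow> 'w \<Rightarrow> int" where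
  "osc_walk \<xi> \<xi>' x 0 \<omega> = x"
| "osc_walk \<xi> \<xi>' x (Suc n) \<omega> =
     osc_walk \<xi> \<xi>' x n \<omega> +
       (if osc_walk \<xi> \<xi>' x n \<omega> \<le> -1 then \<xi> (Suc n) \<omega> else \<xi>' (Suc n) \<omega>)"

text \<open>Below, \<open>X x n \<omega>\<close> is the state at time \<open>n\<close> of a Markov chain started at \<open>x\<close>.\<close>

definition leads_to :: "'w measure \<Rightarrow> ('s \<Rightarrow> nat \<Rightarrow> 'w \<Rightarrow> 's) \<Rightarrow> 's \<Rightarrow> 's \<Rightarrow> bool" where
  "leads_to M X x y \<longleftrightarrow> (\<exists>n. measure M {\<omega> \<in> space M. X x n \<omega> = y} > 0)"

definition irr_class :: "'w measure \<Rightarrow> ('s \<Rightarrow> nat \<Rightarrow> 'w \<Rightarrow> 's) \<Rightarrow> 's \<Rightarrow> 's set" where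
  "irr_class M X x = {y. leads_to M X x y \<and> leads_to M X y x}"

definition irr_classes :: "'w measure \<Rightarrow> ('s \<Rightarrow> nat \<Rightarrow> 'w \<Rightarrow> 's) \<Rightarrow> 's set set" where
  "irr_classes M X = range (irr_class M X)"

definition class_le :: "'w measure \<Rightarrow> ('s \<Rightarrow> nat \<Rightarrow> 'w \<Rightarrow> 's) \<Rightarrow> 's set \<Rightarrow> 's set \<Rightarrow> bool" where
  "class_le M X C C' \<longleftrightarrow> (\<exists>x\<in>C. \<exists>y\<in>C'. leads_to M X x y)"

definition essential_classes :: "'w measure \<Rightarrow> ('s \<Rightarrow> nat \<Rightarrow> 'w \<Rightarrow> 's) \<Rightarrow> 's set set" where
  "essential_classes M X =
     {C \<in> irr_classes M X. \<forall>C'\<in>irr_classes M X. class_le M X C C' \<longrightarrow> C' = C}"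

definition transient :: "'w measure \<Rightarrow> ('s \<Rightarrow> nat \<Rightarrow> 'w \<Rightarrow> 's) \<Rightarrow> 's \<Rightarrow> bool" where
  "transient M X x \<longleftrightarrow> irr_class M X x \<notin> essential_classes M X"

definition reaches_as :: "'w measure \<Rightarrow> ('s \<Rightarrow> nat \<Rightarrow> 'w \<Rightarrow> 's) \<Rightarrow> 's \<Rightarrow> 's set \<Rightarrow> bool" where
  "reaches_as M X x C \<longleftrightarrow> (AE \<omega> in M. \<exists>n. X x n \<omega> \<in> C)"

definition coset :: "int \<Rightarrow> int \<Rightarrow> int set" where
  "coset r m = {r + m * k | k. True}"

end

theory Submission imports Defs begin

text \<open>A point leads to another iff the directed graph of admissible steps joins them. In this
  graph every path is attracted by the closed interval \<open>core\<close>, because the walk cannot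
  overshoot \<open>0\<close> by more than its last step. For fixed steps \<open>s\<close> and \<open>-t\<close>, the walk acts on
  \<open>{-t..s-1}\<close> as a rotation of the integers modulo \<open>s + t\<close>. Hence the displacements that can always
  be realised there form a subgroup, which contains every step of \<open>S\<close> and \<open>S'\<close> lying
  between \<open>-t\<close> and \<open>s\<close>; once \<open>s\<close> and \<open>t\<close> are large enough, it contains \<open>\<delta>\<close>.\<close>

definition osc_step :: "int set \<Rightarrow> int set \<Rightarrow> int \<Rightarrow> int \<Rightarrow> bool" where
  "osc_step S S' x y \<longleftrightarrow> (if x \<le> -1 then y - x \<in> S else y - x \<in> S')"

text \<open>The union of the essential classes: \<open>{D'..D-1}\<close>, a missing maximum or minimum
  being read as an infinite endpoint.\<close>

definition core :: "int set \<Rightarrow> int set \<Rightarrow> int set" where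
  "core S S' = {x. (\<exists>s\<in>S. x < s) \<and> (\<exists>t\<in>S'. t \<le> x)}"

subsection \<open>Additive subgroups of the integers\<close>

lemma subgroup_int_mult_mem:
  fixes H :: "int set"
  assumes "0 \<in> H" and "\<And>a b. a \<in> H \<Longrightarrow> b \<in> H \<Longrightarrow> a + b \<in> H"
    and "\<And>a. a \<in> H \<Longrightarrow> - a \<in> H" and "a \<in> H"
  shows "k * a \<in> H"
proof -
  have nat_mult: "int n * a \<in> H" for n
    using assms by (induction n) (auto simp: algebra_simps)
  show ?thesis
  proof (cases "k \<ge> 0")
    case True
    then show ?thesis using nat_mult[of "nat k"] by simp
  next
    case False
    then show ?thesis using assms(3)[OF nat_mult[of "nat (- k)"]] by simp
  qed
qed

text \<open>Induction on \<open>F\<close>: Bezout writes the gcd of the new element and the old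
  \<open>Gcd\<close> as an integer combination.\<close>

lemma subgroup_int_Gcd_mem:
  fixes H :: "int set"
  assumes "finite F" and "F \<subseteq> H"
    and zero: "0 \<in> H" and add: "\<And>a b. a \<in> H \<Longrightarrow> b \<in> H \<Longrightarrow> a + b \<in> H"
    and neg: "\<And>a. a \<in> H \<Longrightarrow> - a \<in> H"
  shows "Gcd F \<in> H"
  using assms(1,2)
proof (induction F rule: finite_induct)
  case empty
  then show ?case using zero by simp
next
  case (insert a F)
  obtain u v where uv: "u * a + v * Gcd F = gcd a (Gcd F)"
    using bezout_int by blast
  have "u * a + v * Gcd F \<in> H"
    using insert subgroup_int_mult_mem[of H] zero add neg by (intro add) auto
  then show ?case using uv by simp
qed

text \<open>Take a finite subset of least gcd: adjoining any \<open>b\<close> cannot lower that gcd,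
  which therefore divides \<open>b\<close>. This reduces infinite supports to finitely many
  steps.\<close>

lemma finite_subset_Gcd_eq:
  fixes A :: "int set"
  shows "\<exists>F\<subseteq>A. finite F \<and> Gcd F = Gcd A"
proof (cases "A \<subseteq> {0}")
  case True
  then have "finite A" using finite_subset by blast
  then show ?thesis by blast
next
  case False
  then obtain a where a: "a \<in> A" "a \<noteq> 0" by blast
  \<comment> \<open>Forcing the nonzero \<open>a\<close> into \<open>F\<close> keeps
    \<open>Gcd F\<close> positive; otherwise the empty set, of gcd 0, would be the minimum.\<close>
  define P where "P F \<longleftrightarrow> F \<subseteq> A \<and> finite F \<and> a \<in> F" for F
  have "P {a}" using a by (simp add: P_def)
  then obtain F where F: "P F" and min: "\<And>G. P G \<Longrightarrow> nat (Gcd F) \<le> nat (Gcd G)"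
    using ex_has_least_nat[of P "{a}" "\<lambda>F. nat (Gcd F)"] by blast
  have pos: "Gcd F > 0"
    using F a by (metis Gcd_0_iff Gcd_int_greater_eq_0 P_def insert_absorb insert_subset
        order_le_imp_less_or_eq singletonD)
  have "Gcd F dvd b" if "b \<in> A" for b
  proof -
    have "P (insert b F)" using F that by (simp add: P_def)
    then have "nat (Gcd F) \<le> nat (gcd b (Gcd F))" using min by fastforce
    then have "Gcd F \<le> gcd b (Gcd F)" using pos by linarith
    moreover have "gcd b (Gcd F) \<le> Gcd F" using pos by (intro zdvd_imp_le) auto
    ultimately have "gcd b (Gcd F) = Gcd F" by simp
    then show ?thesis by (metis gcd_dvd1)
  qed
  then have "Gcd F dvd Gcd A" by (intro Gcd_greatest)
  moreover have "Gcd A dvd Gcd F"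
    using F by (intro Gcd_greatest Gcd_dvd) (auto simp: P_def)
  ultimately have "Gcd F = Gcd A"
    using pos by (intro zdvd_antisym_nonneg) auto
  then show ?thesis using F by (auto simp: P_def)
qed

subsection \<open>The step graph\<close>

locale osc_graph =
  fixes S S' :: "int set"
  assumes pos: "S \<subseteq> {0<..}" and neg: "S' \<subseteq> {..<0}"
    and ne: "S \<noteq> {}" and ne': "S' \<noteq> {}"
begin

abbreviation reach :: "int \<Rightarrow> int \<Rightarrow> bool" where
  "reach \<equiv> (osc_step S S')\<^sup>*\<^sup>*"

text \<open>An up-step \<open>a\<close> from \<open>x < 0\<close> lands at \<open>x + a < a\<close>,
  so \<open>a\<close> itself certifies the upper bound, and the old lower certificate survives;
  symmetrically for down-steps.\<close>

lemma core_step: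
  assumes "x \<in> core S S'" "osc_step S S' x y"
  shows "y \<in> core S S'"
proof (cases "x \<le> -1")
  case True
  then have "y - x \<in> S" using assms by (simp add: osc_step_def)
  moreover from this have "y - x > 0" using pos by auto
  moreover obtain t where "t \<in> S'" "t \<le> x" using assms by (auto simp: core_def)
  ultimately show ?thesis using True unfolding core_def
    by (intro CollectI conjI bexI[of _ "y - x"] bexI[of _ t]) auto
next
  case False
  then have "y - x \<in> S'" using assms by (simp add: osc_step_def)
  moreover from this have "y - x < 0" using neg by auto
  moreover obtain s where "s \<in> S" "x < s" using assms by (auto simp: core_def)
  ultimately show ?thesis using False unfolding core_def
    by (intro CollectI conjI bexI[of _ "y - x"] bexI[of _ s]) auto
qed

lemma core_reach: "reach x y \<Longrightarrow> x \<in> core S S' \<Longrightarrow> y \<in> core S S'"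
  by (induction rule: rtranclp_induct) (auto intro: core_step)

lemma reach_dvd: "reach x y \<Longrightarrow> Gcd (S \<union> S') dvd y - x"
proof (induction rule: rtranclp_induct)
  case (step y z)
  have "z - y \<in> S \<union> S'" using step(2) by (auto simp: osc_step_def split: if_splits)
  then have "Gcd (S \<union> S') dvd (z - y) + (y - x)" using step by (intro dvd_add) auto
  then show ?case by simp
qed simp

lemma Gcd_pos: "Gcd (S \<union> S') > 0"
proof -
  have "\<not> (S \<union> S' \<subseteq> {0})" using pos ne by force
  then have "Gcd (S \<union> S') \<noteq> 0" by (simp add: Gcd_0_iff)
  then show ?thesis using Gcd_int_greater_eq_0[of "S \<union> S'"] by linarith
qed

text \<open>Every element of \<open>S\<close> is a positive multiple of the gcd, hence exceeds
  \<open>r\<close>. So each residue class has a representative in the core.\<close>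

lemma residue_in_core:
  assumes "0 \<le> r" "r < Gcd (S \<union> S')"
  shows "r \<in> core S S'"
proof -
  obtain s t where st: "s \<in> S" "t \<in> S'" using ne ne' by blast
  then have "s > 0" "t < 0" using pos neg by auto
  moreover have "Gcd (S \<union> S') dvd s" using st by auto
  ultimately have "Gcd (S \<union> S') \<le> s" by (intro zdvd_imp_le)
  then show ?thesis using assms st \<open>t < 0\<close> unfolding core_def
    by (intro CollectI conjI bexI[of _ s] bexI[of _ t]) auto
qed

text \<open>From the nonnegative side the walk decreases until its first negative value, which is
  at least the last step taken; symmetrically from the negative side.\<close>

lemma path_meets_core:
  assumes path: "\<And>n. osc_step S S' (f n) (f (Suc n))"
  shows "\<exists>n. f n \<in> core S S'"
proof (rule ccontr)
  assume "\<not> ?thesis"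
  then have out: "f n \<notin> core S S'" for n by blast
  obtain s t where st: "s \<in> S" "t \<in> S'" using ne ne' by blast
  show False
  proof (cases "f 0 \<le> -1")
    case True
    have "f n \<le> -1 \<and> f n \<ge> f 0 + int n" for n
    proof (induction n)
      case (Suc n)
      then have a: "f (Suc n) - f n \<in> S" using path[of n] by (simp add: osc_step_def)
      then have "f (Suc n) - f n > 0" using pos by auto
      moreover have "\<not> f (Suc n) \<ge> 0"
      proof
        assume "f (Suc n) \<ge> 0"
        moreover have "t < 0" using st neg by auto
        ultimately have "f (Suc n) \<in> core S S'"
          using Suc a st unfolding core_def
          by (intro CollectI conjI bexI[of _ "f (Suc n) - f n"] bexI[of _ t]) auto
        then show False using out by blast
      qed
      ultimately show ?case using Suc by auto
    qed (use True in simp)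
    from this[of "nat (- f 0)"] show False by linarith
  next
    case False
    have "f n \<ge> 0 \<and> f n \<le> f 0 - int n" for n
    proof (induction n)
      case (Suc n)
      then have a: "f (Suc n) - f n \<in> S'" using path[of n] by (simp add: osc_step_def)
      then have "f (Suc n) - f n < 0" using neg by auto
      moreover have "\<not> f (Suc n) < 0"
      proof
        assume "f (Suc n) < 0"
        moreover have "s > 0" using st pos by auto
        ultimately have "f (Suc n) \<in> core S S'"
          using Suc a st unfolding core_def
          by (intro CollectI conjI bexI[of _ "f (Suc n) - f n"] bexI[of _ s]) auto
        then show False using out by blast
      qed
      ultimately show ?case using Suc by auto
    qed (use False in simp)
    \<comment> \<open>The extra 1 is there because 0 counts as nonnegative: the bound has to reach
      -1.\<close>
    from this[of "nat (f 0) + 1"] show False by linarith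
  qed
qed

end

text \<open>Using only the steps \<open>s\<close> and \<open>-t\<close>, the walk moves on \<open>{-t..s-1}\<close>, identified with the
  integers modulo \<open>s + t\<close>, as the rotation by \<open>s\<close>.\<close>

locale osc_window = osc_graph +
  fixes s t :: int
  assumes s: "s \<in> S" and t: "- t \<in> S'"
begin

text \<open>Translations of the integers modulo \<open>s + t\<close> that paths realise from every
  point of the window; uniformity in \<open>x\<close> makes them composable. The paths may use all
  steps and may leave the window.\<close>

definition reach_shift :: "int set" where
  "reach_shift = {h. \<forall>x\<in>{-t..s-1}. \<forall>y\<in>{-t..s-1}. s + t dvd y - x - h \<longrightarrow> reach x y}"

lemma s_pos: "s > 0" and t_pos: "t > 0"
  using s t pos neg by auto

text \<open>The window has \<open>s + t\<close> consecutive elements, so it is a complete residue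
  system modulo \<open>s + t\<close>.\<close>

lemma window_rep: "\<exists>z\<in>{-t..s-1}. s + t dvd z - x"
proof
  have "s + t > 0" using s_pos t_pos by simp
  then have "0 \<le> (x + t) mod (s + t)" "(x + t) mod (s + t) < s + t" by simp_all
  then show "(x + t) mod (s + t) - t \<in> {-t..s-1}" by auto
  have "s + t dvd (x + t) - (x + t) mod (s + t)" by (simp add: dvd_minus_mod)
  then have "s + t dvd - ((x + t) - (x + t) mod (s + t))" by (simp only: dvd_minus_iff)
  then show "s + t dvd (x + t) mod (s + t) - t - x" by (simp add: algebra_simps)
qed

lemma window_unique:
  assumes "x \<in> {-t..s-1}" "y \<in> {-t..s-1}" "s + t dvd y - x"
  shows "x = y"
proof -
  have "\<bar>y - x\<bar> < \<bar>s + t\<bar>" using assms(1,2) by auto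
  then have "y - x = 0" using assms(3) by (meson dvd_imp_le_int leD)
  then show ?thesis by simp
qed

lemma reach_shift_0: "0 \<in> reach_shift"
  unfolding reach_shift_def by (auto dest!: window_unique[rotated 2])

lemma reach_shift_add:
  assumes "a \<in> reach_shift" "b \<in> reach_shift"
  shows "a + b \<in> reach_shift"
  unfolding reach_shift_def
proof (intro CollectI ballI impI)
  fix x y assume xy: "x \<in> {-t..s-1}" "y \<in> {-t..s-1}" "s + t dvd y - x - (a + b)"
  \<comment> \<open>The two paths are joined at the window representative of
    \<open>x + a\<close>.\<close>
  obtain z where z: "z \<in> {-t..s-1}" "s + t dvd z - (x + a)" using window_rep by blast
  have "reach x z" using assms(1) xy z by (auto simp: reach_shift_def algebra_simps)
  moreover have "s + t dvd (y - x - (a + b)) - (z - (x + a))" using xy(3) z(2) by (rule dvd_diff)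
  then have "reach z y" using assms(2) xy z by (auto simp: reach_shift_def algebra_simps)
  ultimately show "reach x y" by simp
qed

lemma reach_shift_cong:
  assumes "a \<in> reach_shift" "s + t dvd b - a"
  shows "b \<in> reach_shift"
  unfolding reach_shift_def
proof (intro CollectI ballI impI)
  fix x y assume xy: "x \<in> {-t..s-1}" "y \<in> {-t..s-1}" "s + t dvd y - x - b"
  have "s + t dvd (y - x - b) + (b - a)" using xy(3) assms(2) by (rule dvd_add)
  then show "reach x y" using assms(1) xy by (auto simp: reach_shift_def algebra_simps)
qed

text \<open>Paths cannot be reversed step by step, but modulo \<open>s + t\<close> the inverse of
  \<open>a\<close> is \<open>(s + t - 1) * a\<close>, a repeated sum of \<open>a\<close>.\<close>

lemma reach_shift_neg:
  assumes "a \<in> reach_shift"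
  shows "- a \<in> reach_shift"
proof -
  have "int n * a \<in> reach_shift" for n
    using reach_shift_0 reach_shift_add[OF assms]
    by (induction n) (auto simp: distrib_right)
  from this[of "nat (s + t - 1)"] have "(s + t - 1) * a \<in> reach_shift"
    using s_pos t_pos by simp
  then show ?thesis
    by (rule reach_shift_cong) (simp add: algebra_simps flip: distrib_left)
qed

text \<open>Since \<open>s\<close> and \<open>- t\<close> agree modulo \<open>s + t\<close>, the
  step dictated by the sign of \<open>x\<close> always realises the same rotation, and it stays in
  the window.\<close>

lemma s_reach_shift: "s \<in> reach_shift"
  unfolding reach_shift_def
proof (intro CollectI ballI impI)
  fix x y assume xy: "x \<in> {-t..s-1}" "y \<in> {-t..s-1}" "s + t dvd y - x - s"
  show "reach x y"
  proof (cases "x \<le> -1")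
    case True
    then have "x + s = y" using xy s_pos by (intro window_unique) (auto simp: algebra_simps)
    then show ?thesis using True s by (intro r_into_rtranclp) (auto simp: osc_step_def)
  next
    case False
    have "s + t dvd (y - x - s) + (s + t)" using xy(3) dvd_refl by (rule dvd_add)
    then have "x - t = y" using False xy t_pos
      by (intro window_unique) (auto simp: algebra_simps)
    then show ?thesis using False t by (intro r_into_rtranclp) (auto simp: osc_step_def)
  qed
qed

lemma mult_s_reach_shift: "k * s \<in> reach_shift"
  by (rule subgroup_int_mult_mem)
    (auto intro: reach_shift_0 reach_shift_add reach_shift_neg s_reach_shift)

text \<open>It suffices to take the step \<open>a\<close> after a suitable number \<open>k\<close> of rotations, which are undone
  afterwards.\<close>

lemma reach_shift_conjugate:
  assumes "\<And>x. x \<in> {-t..s-1} \<Longrightarrow> \<exists>k. \<exists>z\<in>{-t..s-1}.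
    s + t dvd z - (x + k * s) \<and> z + a \<in> {-t..s-1} \<and> osc_step S S' z (z + a)"
  shows "a \<in> reach_shift"
  unfolding reach_shift_def
proof (intro CollectI ballI impI)
  fix x y assume xy: "x \<in> {-t..s-1}" "y \<in> {-t..s-1}" "s + t dvd y - x - a"
  obtain k z where z: "z \<in> {-t..s-1}" "s + t dvd z - (x + k * s)"
    "z + a \<in> {-t..s-1}" "osc_step S S' z (z + a)"
    using assms[OF xy(1)] by blast
  have "reach x z"
    using mult_s_reach_shift[of k] xy z by (auto simp: reach_shift_def algebra_simps)
  also have "reach z (z + a)" using z by blast
  also have "s + t dvd (y - x - a) - (z - (x + k * s))" using xy(3) z(2) by (rule dvd_diff)
  then have "s + t dvd y - (z + a) - (- k) * s" by (simp add: algebra_simps)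
  then have "reach (z + a) y"
    using mult_s_reach_shift[of "- k"] xy z unfolding reach_shift_def by blast
  finally show "reach x y" .
qed

text \<open>Modulo \<open>s + t\<close>, subtracting \<open>t\<close> is the rotation by
  \<open>s\<close>, so \<open>x\<close> can be moved to its representative modulo \<open>t\<close>
  in \<open>{-t..-1}\<close>. There up-steps are allowed, and \<open>a \<le> s\<close> keeps the
  landing point below \<open>s\<close>.\<close>

lemma up_reach_shift:
  assumes a: "a \<in> S" "a \<le> s"
  shows "a \<in> reach_shift"
proof (rule reach_shift_conjugate)
  fix x assume x: "x \<in> {-t..s-1}"
  have a_pos: "a > 0" using a pos by auto
  have "0 \<le> x mod t" "x mod t < t" using t_pos by simp_all
  then have rng: "x mod t - t \<in> {-t..s-1}" "x mod t - t + a \<in> {-t..s-1}" "x mod t - t \<le> -1"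
    using a a_pos s_pos by auto
  have "x mod t - t - (x + (x div t + 1) * s) = - ((s + t) * (x div t + 1))"
    using div_mult_mod_eq[of x t] by (simp add: algebra_simps)
  then have "s + t dvd x mod t - t - (x + (x div t + 1) * s)" by simp
  then show "\<exists>k. \<exists>z\<in>{-t..s-1}. s + t dvd z - (x + k * s) \<and> z + a \<in> {-t..s-1}
      \<and> osc_step S S' z (z + a)"
    using rng a by (intro exI[of _ "x div t + 1"] bexI[of _ "x mod t - t"])
      (auto simp: osc_step_def)
qed

text \<open>Subtracting multiples of \<open>s\<close> brings \<open>x\<close> to
  \<open>x mod s\<close> in \<open>{0..s-1}\<close>, where down-steps are allowed;
  \<open>- t \<le> a\<close> keeps the landing point in the window.\<close>

lemma down_reach_shift:
  assumes a: "a \<in> S'" "- t \<le> a"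
  shows "a \<in> reach_shift"
proof (rule reach_shift_conjugate)
  fix x assume x: "x \<in> {-t..s-1}"
  have a_neg: "a < 0" using a neg by auto
  have "0 \<le> x mod s" "x mod s < s" using s_pos by simp_all
  then have rng: "x mod s \<in> {-t..s-1}" "x mod s + a \<in> {-t..s-1}" "\<not> x mod s \<le> -1"
    using a a_neg t_pos by auto
  have "x mod s - (x + - (x div s) * s) = 0"
    using div_mult_mod_eq[of x s] by (simp add: algebra_simps)
  then have "s + t dvd x mod s - (x + - (x div s) * s)" by simp
  then show "\<exists>k. \<exists>z\<in>{-t..s-1}. s + t dvd z - (x + k * s) \<and> z + a \<in> {-t..s-1}
      \<and> osc_step S S' z (z + a)"
    using rng a by (intro exI[of _ "- (x div s)"] bexI[of _ "x mod s"])
      (auto simp: osc_step_def)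
qed

text \<open>Each element of \<open>F\<close> is a realisable translation, hence so is every multiple
  of \<open>Gcd F\<close>, by the subgroup property.\<close>

lemma window_reach:
  assumes F: "finite F" "F \<subseteq> S \<union> S'" "F \<subseteq> {-t..s}"
    and xy: "x \<in> {-t..s-1}" "y \<in> {-t..s-1}" "Gcd F dvd y - x"
  shows "reach x y"
proof -
  have "F \<subseteq> reach_shift"
    using F up_reach_shift down_reach_shift by fastforce
  then have "Gcd F \<in> reach_shift"
    using F reach_shift_0 reach_shift_add reach_shift_neg
    by (intro subgroup_int_Gcd_mem) auto
  then have "k * Gcd F \<in> reach_shift" for k
    using reach_shift_0 reach_shift_add reach_shift_neg
    by (intro subgroup_int_mult_mem) auto
  moreover obtain k where "y - x = k * Gcd F"
    using xy(3) by (metis dvdE mult.commute)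
  ultimately have "y - x \<in> reach_shift" by metis
  then show ?thesis using xy by (auto simp: reach_shift_def)
qed

end

section \<open>Reachability inside the core\<close>

context osc_graph
begin

text \<open>Finitely many steps already have the full gcd; a window wide enough for them and for
  \<open>x\<close> and \<open>y\<close> then gives the path.\<close>

lemma core_reach_if_dvd:
  assumes xy: "x \<in> core S S'" "y \<in> core S S'" "Gcd (S \<union> S') dvd y - x"
  shows "reach x y"
proof -
  obtain F where F: "F \<subseteq> S \<union> S'" "finite F" "Gcd F = Gcd (S \<union> S')"
    using finite_subset_Gcd_eq by blast
  obtain sx sy tx ty where st: "sx \<in> S" "x < sx" "sy \<in> S" "y < sy"
    "tx \<in> S'" "tx \<le> x" "ty \<in> S'" "ty \<le> y"
    using xy(1,2) by (auto simp: core_def)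
  \<comment> \<open>\<open>s\<close> and \<open>t\<close> must be actual steps even when the
    supports are unbounded, hence extremes of finite sets. The certificates of \<open>x\<close> and
    \<open>y\<close> are included so that both points fall in the window.\<close>
  define A B where "A = insert sx (insert sy (F \<inter> S))" and "B = insert tx (insert ty (F \<inter> S'))"
  define s t where "s = Max A" and "t = Min B"
  have fin: "finite A" "finite B" using F by (auto simp: A_def B_def)
  have "A \<noteq> {}" "B \<noteq> {}" by (auto simp: A_def B_def)
  then have "s \<in> A" "t \<in> B" using fin by (simp_all add: s_def t_def)
  then have stS: "s \<in> S" "t \<in> S'" using st by (auto simp: A_def B_def)
  then have sgn: "s > 0" "t < 0" using pos neg by auto
  have A_le: "a \<le> s" if "a \<in> A" for a using fin that by (simp add: s_def)
  have B_ge: "t \<le> b" if "b \<in> B" for b using fin that by (simp add: t_def)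
  have "t \<le> a \<and> a \<le> s" if "a \<in> F" for a
  proof (cases "a \<in> S")
    case True
    then have "a > 0" "a \<in> A" using pos that by (auto simp: A_def)
    then show ?thesis using A_le[of a] sgn by auto
  next
    case False
    then have "a < 0" "a \<in> B" using F neg that by (auto simp: B_def)
    then show ?thesis using B_ge[of a] sgn by auto
  qed
  \<comment> \<open>\<open>osc_window\<close> takes the size of the down-step, here
    \<open>- t\<close>, whence the double negation.\<close>
  then have F_sub: "F \<subseteq> {- (- t)..s}" by auto
  have win: "x \<in> {- (- t)..s-1}" "y \<in> {- (- t)..s-1}"
    using st A_le[of sx] A_le[of sy] B_ge[of tx] B_ge[of ty] by (auto simp: A_def B_def)
  interpret osc_window S S' s "- t"
    by unfold_locales (use stS in auto)
  show ?thesis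
    using window_reach[OF F(2,1) F_sub win] F(3) xy(3) by simp
qed

lemma reach_core_iff:
  "x \<in> core S S' \<Longrightarrow> reach x y \<longleftrightarrow> y \<in> core S S' \<and> Gcd (S \<union> S') dvd y - x"
  using core_reach core_reach_if_dvd reach_dvd by blast

end

subsection \<open>Positive probability and paths of the step graph\<close>

context
  fixes M :: "'w measure" and \<mu> \<mu>' :: "int pmf" and \<xi> \<xi>' :: "nat \<Rightarrow> 'w \<Rightarrow> int"
  assumes iid: "iid_steps M \<mu> \<mu>' \<xi> \<xi>'"
begin

interpretation prob_space M
  using iid by (simp add: iid_steps_def)

lemma steps_random_variable:
  assumes "n \<ge> 1"
  shows "(\<lambda>\<omega>. (\<xi> n \<omega>, \<xi>' n \<omega>)) \<in> M \<rightarrow>\<^sub>M count_space UNIV"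
    and "\<xi> n \<in> M \<rightarrow>\<^sub>M count_space UNIV" and "\<xi>' n \<in> M \<rightarrow>\<^sub>M count_space UNIV"
proof -
  show pair: "(\<lambda>\<omega>. (\<xi> n \<omega>, \<xi>' n \<omega>)) \<in> M \<rightarrow>\<^sub>M count_space UNIV"
    using iid assms by (auto simp: iid_steps_def indep_vars_def)
  show "\<xi> n \<in> M \<rightarrow>\<^sub>M count_space UNIV"
    using measurable_compose[OF pair, of fst "count_space UNIV"] by simp
  show "\<xi>' n \<in> M \<rightarrow>\<^sub>M count_space UNIV"
    using measurable_compose[OF pair, of snd "count_space UNIV"] by simp
qed

lemma AE_steps_in_support:
  "AE \<omega> in M. \<forall>n\<ge>1. \<xi> n \<omega> \<in> set_pmf \<mu> \<and> \<xi>' n \<omega> \<in> set_pmf \<mu>'"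
proof -
  have "AE \<omega> in M. \<xi> n \<omega> \<in> set_pmf \<mu> \<and> \<xi>' n \<omega> \<in> set_pmf \<mu>'" if n: "n \<ge> 1" for n
  proof -
    have "distr M (count_space UNIV) (\<xi> n) = measure_pmf \<mu>"
      "distr M (count_space UNIV) (\<xi>' n) = measure_pmf \<mu>'"
      using iid n by (auto simp: iid_steps_def)
    then have "AE i in distr M (count_space UNIV) (\<xi> n). i \<in> set_pmf \<mu>"
      "AE i in distr M (count_space UNIV) (\<xi>' n). i \<in> set_pmf \<mu>'"
      by (simp_all only: AE_measure_pmf)
    then show ?thesis
      using steps_random_variable[OF n] by (simp add: AE_distr_iff)
  qed
  then have "AE \<omega> in M. n \<ge> 1 \<longrightarrow> \<xi> n \<omega> \<in> set_pmf \<mu> \<and> \<xi>' n \<omega> \<in> set_pmf \<mu>'" for n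
    by (cases "n \<ge> 1") auto
  then show ?thesis by (simp add: AE_all_countable)
qed

text \<open>The null set depends only on the increments, so one serves all starting points.\<close>

lemma AE_osc_walk_path:
  "AE \<omega> in M. \<forall>x n. osc_step (set_pmf \<mu>) (set_pmf \<mu>') (osc_walk \<xi> \<xi>' x n \<omega>) (osc_walk \<xi> \<xi>' x (Suc n) \<omega>)"
  using AE_steps_in_support by eventually_elim (auto simp: osc_step_def)

lemma osc_walk_reach:
  assumes "\<And>n. osc_step S S' (osc_walk \<xi> \<xi>' x n \<omega>) (osc_walk \<xi> \<xi>' x (Suc n) \<omega>)"
  shows "(osc_step S S')\<^sup>*\<^sup>* x (osc_walk \<xi> \<xi>' x n \<omega>)"
proof (induction n)
  case (Suc n)
  then show ?case using assms[of n] by (rule rtranclp.rtrancl_into_rtrancl)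
qed simp

lemma measurable_osc_walk: "osc_walk \<xi> \<xi>' x n \<in> M \<rightarrow>\<^sub>M count_space UNIV"
proof (induction n)
  case 0
  have "osc_walk \<xi> \<xi>' x 0 = (\<lambda>_. x)" by auto
  then show ?case by simp
next
  case (Suc n)
  note [measurable] = Suc steps_random_variable(2,3)[of "Suc n"]
  have eq: "osc_walk \<xi> \<xi>' x (Suc n) = (\<lambda>\<omega>. osc_walk \<xi> \<xi>' x n \<omega> +
       (if osc_walk \<xi> \<xi>' x n \<omega> \<le> -1 then \<xi> (Suc n) \<omega> else \<xi>' (Suc n) \<omega>))"
    by auto
  show ?case unfolding eq by measurable
qed

text \<open>The event constrains only the coordinate used from \<open>x\<close>, since the marginals
  do not determine the joint law of the pair. Phrasing it as a set of pairs lets independence in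
  time apply.\<close>

lemma osc_step_prob_pos:
  assumes "osc_step (set_pmf \<mu>) (set_pmf \<mu>') x y" "n \<ge> 1"
  shows "\<exists>A. prob ((\<lambda>\<omega>. (\<xi> n \<omega>, \<xi>' n \<omega>)) -` A \<inter> space M) > 0 \<and>
    (\<forall>\<omega>. (\<xi> n \<omega>, \<xi>' n \<omega>) \<in> A \<longrightarrow> x + (if x \<le> -1 then \<xi> n \<omega> else \<xi>' n \<omega>) = y)"
proof -
  have distr: "distr M (count_space UNIV) (\<xi> n) = measure_pmf \<mu>"
    "distr M (count_space UNIV) (\<xi>' n) = measure_pmf \<mu>'"
    using iid assms(2) by (auto simp: iid_steps_def)
  have "prob (\<xi> n -` {k} \<inter> space M) = pmf \<mu> k" "prob (\<xi>' n -` {k} \<inter> space M) = pmf \<mu>' k" for k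
    using measure_distr[OF steps_random_variable(2)[OF assms(2)], of "{k}"]
      measure_distr[OF steps_random_variable(3)[OF assms(2)], of "{k}"]
    unfolding distr by (simp_all add: measure_pmf_single)
  then have pmf: "prob ((\<lambda>\<omega>. (\<xi> n \<omega>, \<xi>' n \<omega>)) -` ({k} \<times> UNIV) \<inter> space M) = pmf \<mu> k"
    "prob ((\<lambda>\<omega>. (\<xi> n \<omega>, \<xi>' n \<omega>)) -` (UNIV \<times> {k}) \<inter> space M) = pmf \<mu>' k" for k
    by (simp_all add: vimage_def)
  show ?thesis
  proof (cases "x \<le> -1")
    case True
    then show ?thesis using assms(1) pmf
      by (intro exI[of _ "{y - x} \<times> UNIV"]) (auto simp: osc_step_def pmf_positive)
  next
    case False
    then show ?thesis using assms(1) pmf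
      by (intro exI[of _ "UNIV \<times> {y - x}"]) (auto simp: osc_step_def pmf_positive)
  qed
qed

text \<open>A path becomes one condition on the pair at each time; together these fix the walk, and
  their joint probability factors by independence.\<close>

lemma reach_imp_cylinder:
  assumes "(osc_step (set_pmf \<mu>) (set_pmf \<mu>'))\<^sup>*\<^sup>* x y"
  shows "\<exists>n A. (\<forall>i\<in>{1..n}. prob ((\<lambda>\<omega>. (\<xi> i \<omega>, \<xi>' i \<omega>)) -` A i \<inter> space M) > 0) \<and>
    (\<forall>\<omega>. (\<forall>i\<in>{1..n}. (\<xi> i \<omega>, \<xi>' i \<omega>) \<in> A i) \<longrightarrow> osc_walk \<xi> \<xi>' x n \<omega> = y)"
  using assms
proof (induction rule: rtranclp_induct)
  case base
  show ?case by (intro exI[of _ 0]) auto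
next
  case (step y z)
  then obtain n A where
    A: "\<And>i. i \<in> {1..n} \<Longrightarrow> prob ((\<lambda>\<omega>. (\<xi> i \<omega>, \<xi>' i \<omega>)) -` A i \<inter> space M) > 0"
      "\<And>\<omega>. (\<And>i. i \<in> {1..n} \<Longrightarrow> (\<xi> i \<omega>, \<xi>' i \<omega>) \<in> A i) \<Longrightarrow> osc_walk \<xi> \<xi>' x n \<omega> = y"
    by blast
  obtain B where B: "prob ((\<lambda>\<omega>. (\<xi> (Suc n) \<omega>, \<xi>' (Suc n) \<omega>)) -` B \<inter> space M) > 0"
      "\<And>\<omega>. (\<xi> (Suc n) \<omega>, \<xi>' (Suc n) \<omega>) \<in> B \<Longrightarrow>
        y + (if y \<le> -1 then \<xi> (Suc n) \<omega> else \<xi>' (Suc n) \<omega>) = z"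
    using osc_step_prob_pos[OF step(2), of "Suc n"] by auto
  show ?case
  proof (intro exI conjI ballI allI impI)
    fix i assume "i \<in> {1..Suc n}"
    then show "prob ((\<lambda>\<omega>. (\<xi> i \<omega>, \<xi>' i \<omega>)) -` (A(Suc n := B)) i \<inter> space M) > 0"
      using A(1)[of i] B(1) by (cases "i = Suc n") auto
  next
    fix \<omega> assume *: "\<forall>i\<in>{1..Suc n}. (\<xi> i \<omega>, \<xi>' i \<omega>) \<in> (A(Suc n := B)) i"
    have "osc_walk \<xi> \<xi>' x n \<omega> = y"
    proof (rule A(2))
      fix i assume "i \<in> {1..n}"
      then show "(\<xi> i \<omega>, \<xi>' i \<omega>) \<in> A i" using *[rule_format, of i] by auto
    qed
    moreover have "(\<xi> (Suc n) \<omega>, \<xi>' (Suc n) \<omega>) \<in> B" using *[rule_format, of "Suc n"] by auto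
    ultimately show "osc_walk \<xi> \<xi>' x (Suc n) \<omega> = z" using B(2) by simp
  qed
qed

text \<open>Almost surely the walk follows the graph, so unreachable points have probability zero;
  conversely a path yields a cylinder whose probability is a product of positive factors.\<close>

lemma leads_to_osc_walk:
  "leads_to M (osc_walk \<xi> \<xi>') = (osc_step (set_pmf \<mu>) (set_pmf \<mu>'))\<^sup>*\<^sup>*"
proof (intro ext iffI)
  fix x y assume "leads_to M (osc_walk \<xi> \<xi>') x y"
  then obtain n where n: "prob {\<omega> \<in> space M. osc_walk \<xi> \<xi>' x n \<omega> = y} > 0"
    by (auto simp: leads_to_def)
  show "(osc_step (set_pmf \<mu>) (set_pmf \<mu>'))\<^sup>*\<^sup>* x y"
  proof (rule ccontr)
    assume no: "\<not> ?thesis"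
    have "AE \<omega> in M. \<not> osc_walk \<xi> \<xi>' x n \<omega> = y"
      using AE_osc_walk_path by eventually_elim (use osc_walk_reach no in blast)
    then have "prob {\<omega> \<in> space M. osc_walk \<xi> \<xi>' x n \<omega> = y} = 0"
      by (intro prob_eq_0_AE)
    then show False using n by simp
  qed
next
  fix x y assume "(osc_step (set_pmf \<mu>) (set_pmf \<mu>'))\<^sup>*\<^sup>* x y"
  then obtain n A where
    A: "\<forall>i\<in>{1..n}. prob ((\<lambda>\<omega>. (\<xi> i \<omega>, \<xi>' i \<omega>)) -` A i \<inter> space M) > 0"
      "\<forall>\<omega>. (\<forall>i\<in>{1..n}. (\<xi> i \<omega>, \<xi>' i \<omega>) \<in> A i) \<longrightarrow> osc_walk \<xi> \<xi>' x n \<omega> = y"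
    using reach_imp_cylinder by blast
  show "leads_to M (osc_walk \<xi> \<xi>') x y"
  \<comment> \<open>With \<open>n = 0\<close> the intersection below would run over no index, giving
    \<open>UNIV\<close> and not the sample space.\<close>
  proof (cases "n = 0")
    case True
    then have "x = y" using A(2) by simp
    then show ?thesis by (auto simp: leads_to_def prob_space intro!: exI[of _ 0])
  next
    case False
    let ?C = "\<Inter>i\<in>{1..n}. (\<lambda>\<omega>. (\<xi> i \<omega>, \<xi>' i \<omega>)) -` A i \<inter> space M"
    have "prob ?C = (\<Prod>i\<in>{1..n}. prob ((\<lambda>\<omega>. (\<xi> i \<omega>, \<xi>' i \<omega>)) -` A i \<inter> space M))"
      using iid False by (intro indep_varsD[where M' = "\<lambda>_. count_space UNIV" and I = "{1..}"])
        (auto simp: iid_steps_def)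
    also have "\<dots> > 0" using A(1) by (intro prod_pos) auto
    finally have "prob ?C > 0" .
    moreover have "prob ?C \<le> prob {\<omega> \<in> space M. osc_walk \<xi> \<xi>' x n \<omega> = y}"
      using A(2) False measurable_osc_walk[of x n]
      by (intro finite_measure_mono) auto
    ultimately show ?thesis unfolding leads_to_def by (intro exI[of _ n]) linarith
  qed
qed

end

subsection \<open>Classes of the oscillating walk\<close>

lemma mem_coset_iff: "y \<in> coset r m \<longleftrightarrow> m dvd y - r"
  by (auto simp: coset_def dvd_def algebra_simps)

lemma coset_mod: "coset (x mod m) m = coset x m"
  by (auto simp: mem_coset_iff mod_eq_dvd_iff[symmetric])

context
  fixes M :: "'w measure" and \<mu> \<mu>' :: "int pmf" and \<xi> \<xi>' :: "nat \<Rightarrow> 'w \<Rightarrow> int"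
    and X :: "int \<Rightarrow> nat \<Rightarrow> 'w \<Rightarrow> int" and S S' :: "int set" and \<delta> :: int
  assumes iid: "iid_steps M \<mu> \<mu>' \<xi> \<xi>'"
    and X: "X = osc_walk \<xi> \<xi>'" and S: "S = set_pmf \<mu>" and S': "S' = set_pmf \<mu>'"
    and pos: "S \<subseteq> {0<..}" and neg: "S' \<subseteq> {..<0}" and \<delta>: "\<delta> = Gcd (S \<union> S')"
begin

interpretation prob_space M
  using iid by (simp add: iid_steps_def)

interpretation osc_graph S S'
  by unfold_locales (use pos neg in \<open>auto simp: S S' set_pmf_not_empty\<close>)

lemma leads_to_eq_reach: "leads_to M X = reach"
  using leads_to_osc_walk[OF iid] by (simp add: X S S')

text \<open>From a core point, being reachable means lying in the core and being congruent modulo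
  \<delta>, a symmetric relation there.\<close>

lemma irr_class_core:
  assumes "x \<in> core S S'"
  shows "irr_class M X x = core S S' \<inter> coset x \<delta>"
  using reach_core_iff[OF assms] reach_core_iff[of _ x] assms
  by (auto simp: irr_class_def leads_to_eq_reach mem_coset_iff \<delta> dvd_diff_commute)

section \<open>Entrance into the core and transience outside it\<close>

lemma AE_walk_path: "AE \<omega> in M. \<forall>x n. osc_step S S' (X x n \<omega>) (X x (Suc n) \<omega>)"
  using AE_osc_walk_path[OF iid] by (simp add: X S S')

text \<open>Every infinite path meets the core, and steps preserve the residue modulo \<delta>;
  almost every trajectory is such a path.\<close>

lemma reaches_core: "reaches_as M X x (core S S' \<inter> coset (x mod \<delta>) \<delta>)"
  unfolding reaches_as_def using AE_walk_path
proof eventually_elim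
  case (elim \<omega>)
  obtain n where n: "X x n \<omega> \<in> core S S'"
    using path_meets_core[of "\<lambda>n. X x n \<omega>"] elim by blast
  have "reach x (X x n \<omega>)"
    using osc_walk_reach[OF iid, of S S' x \<omega> n] elim by (simp add: X)
  then have "X x n \<omega> \<in> coset (x mod \<delta>) \<delta>"
    using reach_dvd by (simp add: coset_mod mem_coset_iff \<delta>)
  then show ?case using n by blast
qed

text \<open>An event of probability one is nonempty, so some trajectory supplies an infinite path to
  which \<open>path_meets_core\<close> applies.\<close>

lemma ex_reach_core: "\<exists>y\<in>core S S'. reach x y"
proof -
  have "\<exists>\<omega>. \<forall>x n. osc_step S S' (X x n \<omega>) (X x (Suc n) \<omega>)"
  proof (rule ccontr)
    assume no: "\<not> ?thesis"
    have "AE \<omega> in M. False" using AE_walk_path by eventually_elim (use no in blast)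
    then show False by simp
  qed
  then obtain \<omega> where \<omega>: "\<And>n. osc_step S S' (X x n \<omega>) (X x (Suc n) \<omega>)" by blast
  then show ?thesis
    using path_meets_core[of "\<lambda>n. X x n \<omega>"] osc_walk_reach[OF iid, of S S' x \<omega>]
    by (auto simp: X)
qed

text \<open>If the class of \<open>x\<close> were essential, it would coincide with the class of a
  core point reached from \<open>x\<close>, and that class lies inside the core.\<close>

lemma transient_if_not_core:
  assumes "x \<notin> core S S'"
  shows "transient M X x"
  unfolding transient_def
proof
  assume ess: "irr_class M X x \<in> essential_classes M X"
  obtain y where y: "y \<in> core S S'" "reach x y" using ex_reach_core by blast
  have "class_le M X (irr_class M X x) (irr_class M X y)"
    using y by (auto simp: class_le_def irr_class_def leads_to_eq_reach)
  then have "irr_class M X y = irr_class M X x"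
    using ess by (auto simp: essential_classes_def irr_classes_def)
  moreover have "x \<in> irr_class M X x" by (simp add: irr_class_def leads_to_eq_reach)
  ultimately show False using assms irr_class_core[OF y(1)] by blast
qed

section \<open>The essential classes and their number\<close>

lemma irr_class_eq_if_mem:
  assumes "y \<in> irr_class M X x"
  shows "irr_class M X y = irr_class M X x"
  using assms unfolding irr_class_def leads_to_eq_reach
  by (auto intro: rtranclp_trans)

text \<open>Whatever a core point reaches stays in the core with the same residue, hence in the same
  class.\<close>

lemma irr_class_core_essential:
  assumes "x \<in> core S S'"
  shows "irr_class M X x \<in> essential_classes M X"
proof -
  have "irr_class M X z = irr_class M X x"
    if le: "class_le M X (irr_class M X x) (irr_class M X z)" for z
  proof -
    obtain u v where u: "u \<in> irr_class M X x" and v: "v \<in> irr_class M X z" and "reach u v"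
      using le unfolding class_le_def leads_to_eq_reach by blast
    then have "reach x v" by (auto simp: irr_class_def leads_to_eq_reach)
    then have "v \<in> irr_class M X x"
      using reach_core_iff[OF assms] irr_class_core[OF assms]
      by (auto simp: mem_coset_iff \<delta>)
    then show ?thesis using v irr_class_eq_if_mem by blast
  qed
  then show ?thesis by (auto simp: essential_classes_def irr_classes_def)
qed

lemma irr_class_core_image:
  "irr_class M X ` core S S' = (\<lambda>r. core S S' \<inter> coset r \<delta>) ` {0..<\<delta>}"
proof (intro equalityI image_subsetI)
  fix x assume x: "x \<in> core S S'"
  then have "irr_class M X x = core S S' \<inter> coset (x mod \<delta>) \<delta>"
    by (simp add: irr_class_core coset_mod)
  moreover have "x mod \<delta> \<in> {0..<\<delta>}" using Gcd_pos by (simp add: \<delta>)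
  ultimately show "irr_class M X x \<in> (\<lambda>r. core S S' \<inter> coset r \<delta>) ` {0..<\<delta>}" by blast
next
  fix r assume "r \<in> {0..<\<delta>}"
  then have "r \<in> core S S'" using residue_in_core by (simp add: \<delta>)
  then show "core S S' \<inter> coset r \<delta> \<in> irr_class M X ` core S S'"
    by (metis image_eqI irr_class_core)
qed

lemma essential_classes_eq:
  "essential_classes M X = (\<lambda>r. core S S' \<inter> coset r \<delta>) ` {0..<\<delta>}"
proof -
  have "essential_classes M X = irr_class M X ` core S S'"
  proof (intro equalityI subsetI)
    fix C assume C: "C \<in> essential_classes M X"
    then obtain x where "C = irr_class M X x"
      by (auto simp: essential_classes_def irr_classes_def)
    moreover from this have "x \<in> core S S'"
      using C transient_if_not_core[of x] by (auto simp: transient_def)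
    ultimately show "C \<in> irr_class M X ` core S S'" by blast
  qed (auto intro: irr_class_core_essential)
  then show ?thesis by (simp add: irr_class_core_image)
qed

lemma card_essential_classes: "int (card (essential_classes M X)) = \<delta>"
proof -
  have "inj_on (\<lambda>r. core S S' \<inter> coset r \<delta>) {0..<\<delta>}"
  proof (rule inj_onI)
    fix r r' assume r: "r \<in> {0..<\<delta>}" "r' \<in> {0..<\<delta>}"
      and eq: "core S S' \<inter> coset r \<delta> = core S S' \<inter> coset r' \<delta>"
    \<comment> \<open>Each remainder witnesses its own class, so equal classes force congruent
      remainders.\<close>
    have "r \<in> core S S'" using r residue_in_core by (simp add: \<delta>)
    then have "r \<in> core S S' \<inter> coset r \<delta>" by (simp add: mem_coset_iff)
    then have "\<delta> dvd r - r'" using eq by (simp add: mem_coset_iff)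
    then have "r mod \<delta> = r' mod \<delta>" by (simp add: mod_eq_dvd_iff)
    then show "r = r'" using r by simp
  qed
  then show ?thesis using Gcd_pos by (simp add: essential_classes_eq card_image \<delta>)
qed

text \<open>Bounded and unbounded supports are treated at once; only the shape of
  \<open>core\<close> distinguishes the cases.\<close>

lemma core_classification:
  "essential_classes M X = (\<lambda>r. core S S' \<inter> coset r \<delta>) ` {0..<\<delta>} \<and>
   int (card (essential_classes M X)) = \<delta> \<and>
   irr_class M X 0 = core S S' \<inter> coset 0 \<delta> \<and>
   (\<forall>x. x \<notin> core S S' \<longrightarrow>
      transient M X x \<and> reaches_as M X x (core S S' \<inter> coset (x mod \<delta>) \<delta>)) \<and>
   (core S S' = UNIV \<longrightarrow> irr_classes M X = essential_classes M X)"
proof (intro conjI allI impI)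
  show "irr_class M X 0 = core S S' \<inter> coset 0 \<delta>"
    using Gcd_pos by (intro irr_class_core residue_in_core) auto
  show "irr_classes M X = essential_classes M X" if "core S S' = UNIV"
    using irr_class_core_image that by (simp add: irr_classes_def essential_classes_eq)
qed (simp_all add: essential_classes_eq[symmetric] card_essential_classes reaches_core
  transient_if_not_core)

end

section \<open>The core as an interval\<close>

lemma less_some_iff_less_Max:
  fixes A :: "int set"
  assumes "bdd_above A" "A \<subseteq> {0<..}" "A \<noteq> {}"
  shows "(\<exists>a\<in>A. x < a) \<longleftrightarrow> x \<le> Max A - 1"
proof -
  obtain b where "\<And>a. a \<in> A \<Longrightarrow> a \<le> b" using assms(1) by (auto simp: bdd_above_def)
  \<comment> \<open>Positivity gives the missing lower bound, so \<open>A\<close> is finite and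
    \<open>Max\<close> is meaningful.\<close>
  then have "A \<subseteq> {0..b}" using assms(2) by force
  then have "finite A" using finite_subset by blast
  then show ?thesis using Max_gr_iff[of A x] assms(3) by auto
qed

lemma some_le_iff_Min_le:
  fixes A :: "int set"
  assumes "bdd_below A" "A \<subseteq> {..<0}" "A \<noteq> {}"
  shows "(\<exists>a\<in>A. a \<le> x) \<longleftrightarrow> Min A \<le> x"
proof -
  obtain b where "\<And>a. a \<in> A \<Longrightarrow> b \<le> a" using assms(1) by (auto simp: bdd_below_def)
  then have "A \<subseteq> {b..0}" using assms(2) by force
  then have "finite A" using finite_subset by blast
  then show ?thesis using Min_le_iff[of A x] assms(3) by auto
qed

theorem theorem2p1:
  fixes M :: "'w measure"
    and \<mu> \<mu>' :: "int pmf"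
    and \<xi> \<xi>' :: "nat \<Rightarrow> 'w \<Rightarrow> int"
    and X :: "int \<Rightarrow> nat \<Rightarrow> 'w \<Rightarrow> int"
    and S S' :: "int set"
    and D D' d d' \<delta> :: int
  assumes "iid_steps M \<mu> \<mu>' \<xi> \<xi>'"
    and "X = osc_walk \<xi> \<xi>'"
    and "S = set_pmf \<mu>" and "S' = set_pmf \<mu>'"
    and "S \<subseteq> {0<..}" and "S' \<subseteq> {..<0}"
    and "d = Gcd S" and "d' = Gcd S'" and "\<delta> = gcd d d'"
    and "bdd_above S \<Longrightarrow> D = Max S"
    and "bdd_below S' \<Longrightarrow> D' = Min S'"
  shows
    "(bdd_above S \<and> bdd_below S' \<longrightarrow>
        essential_classes M X = (\<lambda>r. {D'..D-1} \<inter> coset r \<delta>) ` {0..<\<delta>} \<and>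
        int (card (essential_classes M X)) = \<delta> \<and>
        irr_class M X 0 = {D'..D-1} \<inter> coset 0 \<delta> \<and>
        (\<forall>x. x \<ge> D \<or> x < D' \<longrightarrow>
           transient M X x \<and> reaches_as M X x ({D'..D-1} \<inter> coset (x mod \<delta>) \<delta>)))
   \<and> (\<not> bdd_below S' \<and> bdd_above S \<longrightarrow>
        essential_classes M X = (\<lambda>r. {..D-1} \<inter> coset r \<delta>) ` {0..<\<delta>} \<and>
        int (card (essential_classes M X)) = \<delta> \<and>
        (\<forall>x\<ge>D. transient M X x \<and> reaches_as M X x ({..D-1} \<inter> coset (x mod \<delta>) \<delta>)))
   \<and> (bdd_below S' \<and> \<not> bdd_above S \<longrightarrow>
        essential_classes M X = (\<lambda>r. {D'..} \<inter> coset r \<delta>) ` {0..<\<delta>} \<and>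
        int (card (essential_classes M X)) = \<delta> \<and>
        (\<forall>x<D'. transient M X x \<and> reaches_as M X x ({D'..} \<inter> coset (x mod \<delta>) \<delta>)))
   \<and> (\<not> bdd_above S \<and> \<not> bdd_below S' \<longrightarrow>
        irr_classes M X = (\<lambda>r. coset r \<delta>) ` {0..<\<delta>} \<and>
        int (card (irr_classes M X)) = \<delta> \<and>
        essential_classes M X = irr_classes M X)"
proof -
  have ne: "S \<noteq> {}" "S' \<noteq> {}" using assms(3,4) by (auto simp: set_pmf_not_empty)
  have \<delta>: "\<delta> = Gcd (S \<union> S')" using assms(7-9) by (intro zdvd_antisym_nonneg)
      (auto intro!: Gcd_greatest intro: dvd_trans[OF gcd_dvd1] dvd_trans[OF gcd_dvd2])
  note cls = core_classification[OF assms(1-6) \<delta>]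
  \<comment> \<open>For unbounded \<open>S\<close> both sides are true whatever the value of
    \<open>D\<close>, which is then unconstrained.\<close>
  have up: "(\<exists>s\<in>S. x < s) \<longleftrightarrow> (bdd_above S \<longrightarrow> x \<le> D - 1)" for x
    using less_some_iff_less_Max[of S x] assms(5,10) ne
    by (cases "bdd_above S") (auto simp: bdd_above_def not_le)
  have down: "(\<exists>t\<in>S'. t \<le> x) \<longleftrightarrow> (bdd_below S' \<longrightarrow> D' \<le> x)" for x
  proof (cases "bdd_below S'")
    case True
    then show ?thesis using some_le_iff_Min_le[of S' x] assms(6,11) ne by simp
  next
    case False
    then obtain t where "t \<in> S'" "t < x" by (auto simp: bdd_below_def not_le)
    then show ?thesis using False by (auto intro!: bexI[of _ t])
  qed
  have core: "core S S' = {x. (bdd_above S \<longrightarrow> x \<le> D - 1) \<and> (bdd_below S' \<longrightarrow> D' \<le> x)}"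
    by (simp only: core_def up down)
  consider (fin) "bdd_above S" "bdd_below S'" | (inf_down) "bdd_above S" "\<not> bdd_below S'"
    | (inf_up) "\<not> bdd_above S" "bdd_below S'" | (inf) "\<not> bdd_above S" "\<not> bdd_below S'"
    by metis
  then show ?thesis
  proof cases
    case fin
    then have "core S S' = {D'..D-1}" by (auto simp: core)
    then show ?thesis using cls fin by auto
  next
    case inf_down
    then have "core S S' = {..D-1}" by (auto simp: core)
    then show ?thesis using cls inf_down by auto
  next
    case inf_up
    then have "core S S' = {D'..}" by (auto simp: core)
    then show ?thesis using cls inf_up by auto
  next
    case inf
    then have "core S S' = UNIV" by (auto simp: core)
    then show ?thesis using cls inf by auto
  qed
qed

end
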